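(* Let $G$ be an $r$-regular simple mixed graph on $n$ vertices, and let $\boldsymbol{\lambda}_{2n}(G)$ be the smallest eigenvalue of $\mathcal{I}(G)$. Then the independence number of $G$ satisfies $$\alpha(G)\le\frac{-n\boldsymbol{\lambda}_{2n}(G)}{r-\boldsymbol{\lambda}_{2n}(G)}.$$
   Context: A mixed graph $G$ has a finite nonempty vertex set $V_G=\{v_1,\dots,v_n\}$, a set $E_G$ of (undirected) edges, each joining an unordered pair of vertices $\{u,v\}$ (a loop if $u=v$), and a set $\vec E_G$ of arcs, each going from $u$ to $v$ for an ordered pair $(u,v)$ of vertices (a directed loop if $u=v$); multiple edges, loops, arcs and directed loops are allowed. $G$ is simple if it has no loops, no directed loops, at most one edge joining any two vertices, and at most one arc from $u$ to $v$ for each ordered pair $(u,v)$ (an edge and arcs in both directions may coexist on the same pair of vertices). The integrated adjacency matrix $\mathcal{I}(G)$ is the real symmetric $2n\times 2n$ matrix $\begin{bmatrix}A&D\\ D^T&A\end{bmatrix}$, where $A_{ij}$ ($i\neq j$) is the number of edges joining $v_i$ and $v_j$, $A_{ii}$ is twice the number of loops at $v_i$, and $D_{ij}$ is the number of arcs from $v_i$ to $v_j$. Its eigenvalues are ordered $\boldsymbol{\lambda}_1(G)\ge\cdots\ge\boldsymbol{\lambda}_{2n}(G)$. Degrees: $d(u)$ is the number of edges incident with $u$ (loops counted twice), $d^+(u)$ the number of arcs starting at $u$, $d^-(u)$ the number of arcs ending at $u$. $G$ is $r$-regular if $d^+(u)=d^-(u)$ and $d(u)+d^+(u)=r$ for all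 $u\in V_G$. Two vertices are adjacent if there is an edge joining them or an arc between them in at least one direction. An independent set is a set of vertices no two of which are adjacent; $\alpha(G)$ is the largest size of an independent set of $G$. *)

theory Defs
  imports "Jordan_Normal_Form.Spectral_Radius"
begin

(* Edges and arcs are labelled objects, so that parallel edges and arcs can be counted.
   An edge e joins u and v iff ends e = {u, v}; a loop at v has ends e = {v}. *)
record ('v, 'e, 'a) mixed_graph =
  verts :: "'v set"
  edges :: "'e set"
  ends :: "'e \<Rightarrow> 'v set"
  arcs :: "'a set"
  tail :: "'a \<Rightarrow> 'v"
  head :: "'a \<Rightarrow> 'v"

locale mixed_graph =
  fixes G :: "('v, 'e, 'a) mixed_graph"
  assumes finite_verts: "finite (verts G)"
    and verts_nonempty: "verts G \<noteq> {}"
    and finite_edges: "finite (edges G)"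
    and ends_wf: "e \<in> edges G \<Longrightarrow> \<exists>u\<in>verts G. \<exists>v\<in>verts G. ends G e = {u, v}"
    and finite_arcs: "finite (arcs G)"
    and tail_wf: "a \<in> arcs G \<Longrightarrow> tail G a \<in> verts G"
    and head_wf: "a \<in> arcs G \<Longrightarrow> head G a \<in> verts G"

definition edges_between :: "('v, 'e, 'a) mixed_graph \<Rightarrow> 'v \<Rightarrow> 'v \<Rightarrow> 'e set" where
  "edges_between G u v = {e \<in> edges G. ends G e = {u, v}}"

definition arcs_from_to :: "('v, 'e, 'a) mixed_graph \<Rightarrow> 'v \<Rightarrow> 'v \<Rightarrow> 'a set" where
  "arcs_from_to G u v = {a \<in> arcs G. tail G a = u \<and> head G a = v}"

locale simple_mixed_graph = mixed_graph G
  for G :: "('v, 'e, 'a) mixed_graph" +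
  assumes no_loops: "v \<in> verts G \<Longrightarrow> edges_between G v v = {}"
    and no_directed_loops: "v \<in> verts G \<Longrightarrow> arcs_from_to G v v = {}"
    and no_multi_edges: "\<lbrakk>u \<in> verts G; v \<in> verts G\<rbrakk> \<Longrightarrow> card (edges_between G u v) \<le> 1"
    and no_multi_arcs: "\<lbrakk>u \<in> verts G; v \<in> verts G\<rbrakk> \<Longrightarrow> card (arcs_from_to G u v) \<le> 1"

(* The second summand counts every loop a second time. *)
definition degree :: "('v, 'e, 'a) mixed_graph \<Rightarrow> 'v \<Rightarrow> nat" where
  "degree G u = card {e \<in> edges G. u \<in> ends G e} + card (edges_between G u u)"

definition out_degree :: "('v, 'e, 'a) mixed_graph \<Rightarrow> 'v \<Rightarrow> nat" where
  "out_degree G u = card {a \<in> arcs G. tail G a = u}"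

definition in_degree :: "('v, 'e, 'a) mixed_graph \<Rightarrow> 'v \<Rightarrow> nat" where
  "in_degree G u = card {a \<in> arcs G. head G a = u}"

definition regular :: "('v, 'e, 'a) mixed_graph \<Rightarrow> nat \<Rightarrow> bool" where
  "regular G r \<longleftrightarrow>
    (\<forall>u\<in>verts G. out_degree G u = in_degree G u \<and> degree G u + out_degree G u = r)"

(* Matrices are taken with respect to an enumeration vs of the vertices. *)
definition undirected_adjacency_mat :: "('v, 'e, 'a) mixed_graph \<Rightarrow> 'v list \<Rightarrow> real mat" where
  "undirected_adjacency_mat G vs = mat (length vs) (length vs) (\<lambda>(i, j).
     if i = j then 2 * real (card (edges_between G (vs ! i) (vs ! i)))
     else real (card (edges_between G (vs ! i) (vs ! j))))"

definition arc_adjacency_mat :: "('v, 'e, 'a) mixed_graph \<Rightarrow> 'v list \<Rightarrow> real mat" where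
  "arc_adjacency_mat G vs = mat (length vs) (length vs) (\<lambda>(i, j).
     real (card (arcs_from_to G (vs ! i) (vs ! j))))"

definition integrated_adjacency_mat :: "('v, 'e, 'a) mixed_graph \<Rightarrow> 'v list \<Rightarrow> real mat" where
  "integrated_adjacency_mat G vs =
     (let A = undirected_adjacency_mat G vs; D = arc_adjacency_mat G vs
      in four_block_mat A D (transpose_mat D) A)"

(* Intended for matrices with a real eigenvalue, in particular nonempty real symmetric ones;
   otherwise this is the unspecified value Min {}. *)
definition smallest_eigenvalue :: "real mat \<Rightarrow> real" where
  "smallest_eigenvalue M = Min (spectrum M)"

definition adjacent :: "('v, 'e, 'a) mixed_graph \<Rightarrow> 'v \<Rightarrow> 'v \<Rightarrow> bool" where
  "adjacent G u v \<longleftrightarrow>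
     edges_between G u v \<noteq> {} \<or> arcs_from_to G u v \<noteq> {} \<or> arcs_from_to G v u \<noteq> {}"

definition independent_set :: "('v, 'e, 'a) mixed_graph \<Rightarrow> 'v set \<Rightarrow> bool" where
  "independent_set G S \<longleftrightarrow>
     S \<subseteq> verts G \<and> (\<forall>u\<in>S. \<forall>v\<in>S. u \<noteq> v \<longrightarrow> \<not> adjacent G u v)"

definition independence_number :: "('v, 'e, 'a) mixed_graph \<Rightarrow> nat" where
  "independence_number G = Max (card ` {S. independent_set G S})"

end

theory Submission
  imports Defs
begin

text \<open>
  This is Hoffman's ratio bound, applied to the symmetric matrix \<open>M = [A, D; D\<^sup>T, A]\<close> of order
  \<open>2n\<close>. Regularity makes every row sum of \<open>M\<close> equal to \<open>r\<close>: a row of the upper half adds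
  up to \<open>d(u) + d\<^sup>+(u)\<close>, a row of the lower half to \<open>d(u) + d\<^sup>-(u)\<close>. If \<open>S\<close> is independent,
  then the rows and columns that belong to \<open>S\<close>, taken in both halves, meet in a zero block
  of order \<open>2 |S|\<close>. So the indicator vector \<open>z\<close> of these \<open>2 |S|\<close> indices satisfies
  \<open>z \<bullet> M z = 0\<close>, while \<open>M 1 = r 1\<close>. The bound follows by comparing \<open>y \<bullet> M y\<close> with
  \<open>\<lambda> (y \<bullet> y)\<close> for a multiple \<open>y\<close> of the component of \<open>z\<close> orthogonal to the all-ones
  vector \<open>1\<close>, where \<open>\<lambda>\<close> is the smallest eigenvalue (\<open>zero_block_ratio_bound\<close>).

  The spectral input is the inequality \<open>\<lambda> (x \<bullet> x) \<le> x \<bullet> M x\<close> for real symmetric \<open>M\<close>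
  (\<open>smallest_eigenvalue_rayleigh\<close>), which is obtained by a maximality argument. Let \<open>m\<close> be
  the largest number such that \<open>M - m I\<close> is positive semidefinite. If
  \<open>m\<close> were not an eigenvalue, then \<open>M - m I\<close> would be invertible, and an invertible positive
  semidefinite matrix is bounded below by a positive multiple of the identity, so \<open>m\<close> could
  be enlarged. Hence \<open>m\<close> is an eigenvalue, and \<open>\<lambda> \<le> m\<close>.
\<close>

section \<open>Quadratic forms of real matrices\<close>

lemma quadratic_form_sum:
  fixes M :: "real mat"
  assumes "M \<in> carrier_mat N N" "x \<in> carrier_vec N"
  shows "x \<bullet> (M *\<^sub>v x) = (\<Sum>i<N. \<Sum>j<N. M $$ (i, j) * (x $ i * x $ j))"
  using assms
  by (auto simp: scalar_prod_def sum_distrib_left lessThan_atLeast0 mult.left_commute intro!: sum.cong)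

lemma self_scalar_prod_sum:
  "x \<in> carrier_vec N \<Longrightarrow> x \<bullet> x = (\<Sum>i<N. (x $ i :: real)\<^sup>2)"
  by (auto simp: scalar_prod_def lessThan_atLeast0 power2_eq_square)

lemma quadratic_form_bounded:
  fixes M :: "real mat"
  assumes M: "M \<in> carrier_mat N N"
  obtains K where "K > 0" "\<And>x. x \<in> carrier_vec N \<Longrightarrow> x \<bullet> (M *\<^sub>v x) \<le> K * (x \<bullet> x)"
proof
  define K where "K = (\<Sum>i<N. \<Sum>j<N. \<bar>M $$ (i, j)\<bar>)"
  show "K + 1 > 0"
    unfolding K_def by (intro add_nonneg_pos sum_nonneg) auto
  fix x :: "real vec" assume x: "x \<in> carrier_vec N"
  have entry: "(x $ i)\<^sup>2 \<le> x \<bullet> x" if "i < N" for i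
    unfolding self_scalar_prod_sum[OF x] using that by (intro member_le_sum) auto
  have entry_bound: "M $$ (i, j) * (x $ i * x $ j) \<le> \<bar>M $$ (i, j)\<bar> * (x \<bullet> x)" if "i < N" "j < N" for i j
  proof -
    have "2 * \<bar>x $ i * x $ j\<bar> \<le> (x $ i)\<^sup>2 + (x $ j)\<^sup>2"
      using sum_squares_bound[of "\<bar>x $ i\<bar>" "\<bar>x $ j\<bar>"] by (simp add: abs_mult)
    then have "\<bar>x $ i * x $ j\<bar> \<le> x \<bullet> x"
      using entry[OF that(1)] entry[OF that(2)] by linarith
    then have "\<bar>M $$ (i, j)\<bar> * \<bar>x $ i * x $ j\<bar> \<le> \<bar>M $$ (i, j)\<bar> * (x \<bullet> x)"
      by (intro mult_left_mono) auto
    then show ?thesis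
      using abs_ge_self[of "M $$ (i, j) * (x $ i * x $ j)"] unfolding abs_mult by linarith
  qed
  have "x \<bullet> (M *\<^sub>v x) \<le> K * (x \<bullet> x)"
    unfolding quadratic_form_sum[OF M x] K_def sum_distrib_right
    by (intro sum_mono entry_bound) auto
  moreover have "x \<bullet> x \<ge> 0"
    unfolding self_scalar_prod_sum[OF x] by (intro sum_nonneg) auto
  ultimately show "x \<bullet> (M *\<^sub>v x) \<le> (K + 1) * (x \<bullet> x)"
    by (simp add: distrib_right)
qed

section \<open>The smallest eigenvalue as a lower bound of the Rayleigh quotient\<close>

lemma char_matrix_quadratic_form:
  fixes M :: "real mat"
  assumes M: "M \<in> carrier_mat N N" and x: "x \<in> carrier_vec N"
  shows "x \<bullet> (char_matrix M t *\<^sub>v x) = x \<bullet> (M *\<^sub>v x) - t * (x \<bullet> x)"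
proof -
  have "char_matrix M t *\<^sub>v x = M *\<^sub>v x + (- t) \<cdot>\<^sub>v x"
    unfolding char_matrix_def
    by (rule eq_vecI) (use M x in \<open>auto simp: add_scalar_prod_distrib[of _ N]\<close>)
  then show ?thesis
    using M x by (simp add: scalar_prod_add_distrib[of _ N])
qed

text \<open>
  The form of \<open>B\<close> is nonnegative at \<open>x - s B x\<close> for every \<open>s\<close>; expanding this at \<open>s = 1 / K\<close>,
  where \<open>K\<close> bounds the form on unit vectors, gives the claim. The estimate plays the part of
  the spectral fact \<open>B\<^sup>2 \<le> K B\<close>.
\<close>

lemma psd_image_norm_bound:
  fixes B :: "real mat"
  assumes B: "B \<in> carrier_mat N N" and sym: "transpose_mat B = B"
    and psd: "\<And>x. x \<in> carrier_vec N \<Longrightarrow> 0 \<le> x \<bullet> (B *\<^sub>v x)"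
  obtains K where "K > 0"
    "\<And>x. x \<in> carrier_vec N \<Longrightarrow> (B *\<^sub>v x) \<bullet> (B *\<^sub>v x) \<le> K * (x \<bullet> (B *\<^sub>v x))"
proof -
  obtain K where K: "K > 0" "\<And>x. x \<in> carrier_vec N \<Longrightarrow> x \<bullet> (B *\<^sub>v x) \<le> K * (x \<bullet> x)"
    using quadratic_form_bounded[OF B] by blast
  show ?thesis
  proof (rule that[OF K(1)])
    fix x :: "real vec" assume x: "x \<in> carrier_vec N"
    define y where "y = B *\<^sub>v x"
    have y: "y \<in> carrier_vec N" and By: "B *\<^sub>v y \<in> carrier_vec N"
      using B x unfolding y_def by auto
    define s where "s = 1 / K"
    have xBy: "x \<bullet> (B *\<^sub>v y) = y \<bullet> y"
      using transpose_vec_mult_scalar[OF B y x] unfolding sym y_def[symmetric]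
      using x By comm_scalar_prod by metis
    have "0 \<le> (x - s \<cdot>\<^sub>v y) \<bullet> (B *\<^sub>v (x - s \<cdot>\<^sub>v y))"
      using x y by (intro psd) auto
    also have "B *\<^sub>v (x - s \<cdot>\<^sub>v y) = y - s \<cdot>\<^sub>v (B *\<^sub>v y)"
      using B x y by (simp add: mult_minus_distrib_mat_vec[OF B] mult_mat_vec[OF B] y_def)
    also have "(x - s \<cdot>\<^sub>v y) \<bullet> (y - s \<cdot>\<^sub>v (B *\<^sub>v y))
        = x \<bullet> y - 2 * s * (y \<bullet> y) + s\<^sup>2 * (y \<bullet> (B *\<^sub>v y))"
      using x y By xBy
      by (simp add: minus_scalar_prod_distrib[of _ N] scalar_prod_minus_distrib[of _ N]
          power2_eq_square algebra_simps)
    also have "\<dots> \<le> x \<bullet> y - 2 * s * (y \<bullet> y) + s\<^sup>2 * (K * (y \<bullet> y))"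
      using K(2)[OF y] by (intro add_left_mono mult_left_mono) auto
    also have "\<dots> = x \<bullet> y - (y \<bullet> y) / K"
      using K(1) by (simp add: s_def power2_eq_square field_simps)
    finally have "(y \<bullet> y) / K \<le> x \<bullet> y"
      by simp
    then show "(B *\<^sub>v x) \<bullet> (B *\<^sub>v x) \<le> K * (x \<bullet> (B *\<^sub>v x))"
      using K(1) unfolding y_def[symmetric] by (simp add: field_simps)
  qed
qed

text \<open>
  The matrix \<open>B = M - t I\<close> is positive semidefinite and has an inverse \<open>C\<close>. With \<open>y = B x\<close>,
  the squared norm of \<open>x = C y\<close> is at most a constant times \<open>y \<bullet> y\<close>, which by the previous
  lemma is at most a constant times \<open>x \<bullet> B x\<close>.
\<close>

lemma rayleigh_bound_improves_off_spectrum: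
  fixes M :: "real mat"
  assumes M: "M \<in> carrier_mat N N" and sym: "transpose_mat M = M"
    and bound: "\<And>x. x \<in> carrier_vec N \<Longrightarrow> t * (x \<bullet> x) \<le> x \<bullet> (M *\<^sub>v x)"
    and not_eigenvalue: "\<not> eigenvalue M t"
  obtains \<epsilon> where "\<epsilon> > 0"
    "\<And>x. x \<in> carrier_vec N \<Longrightarrow> (t + \<epsilon>) * (x \<bullet> x) \<le> x \<bullet> (M *\<^sub>v x)"
proof -
  define B where "B = char_matrix M t"
  have B: "B \<in> carrier_mat N N"
    using M unfolding B_def by simp
  have Bsym: "transpose_mat B = B"
  proof (rule eq_matI)
    fix i j assume "i < dim_row B" "j < dim_col B"
    moreover from this have "M $$ (j, i) = M $$ (i, j)"
      using arg_cong[OF sym, of "\<lambda>A. A $$ (i, j)"] M B by simp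
    ultimately show "transpose_mat B $$ (i, j) = B $$ (i, j)"
      using M B unfolding B_def char_matrix_def by auto
  qed (use B in auto)
  have psd: "0 \<le> x \<bullet> (B *\<^sub>v x)" if "x \<in> carrier_vec N" for x
    using bound[OF that] char_matrix_quadratic_form[OF M that, of t] unfolding B_def by simp
  have "det B \<noteq> 0"
    using not_eigenvalue eigenvalue_det[OF M] unfolding B_def by simp
  then have "B \<in> Units (ring_mat TYPE(real) N ())"
    by (rule det_non_zero_imp_unit[OF B])
  then obtain C where C: "C \<in> carrier_mat N N" and CB: "C * B = 1\<^sub>m N"
    unfolding Units_def ring_mat_def by auto
  obtain K where K: "K > 0"
    "\<And>x. x \<in> carrier_vec N \<Longrightarrow> (B *\<^sub>v x) \<bullet> (B *\<^sub>v x) \<le> K * (x \<bullet> (B *\<^sub>v x))"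
    using psd_image_norm_bound[OF B Bsym psd] by blast
  obtain L where L: "L > 0"
    "\<And>y. y \<in> carrier_vec N \<Longrightarrow> y \<bullet> ((transpose_mat C * C) *\<^sub>v y) \<le> L * (y \<bullet> y)"
    using quadratic_form_bounded[of "transpose_mat C * C" N] C by auto
  show ?thesis
  proof (rule that[of "1 / (L * K)"])
    show "1 / (L * K) > 0"
      using K(1) L(1) by simp
    fix x :: "real vec" assume x: "x \<in> carrier_vec N"
    define y where "y = B *\<^sub>v x"
    have y: "y \<in> carrier_vec N"
      using B x unfolding y_def by auto
    have xCy: "x = C *\<^sub>v y"
      using assoc_mult_mat_vec[OF C B x] x unfolding CB y_def by simp
    have "x \<bullet> x = y \<bullet> (transpose_mat C *\<^sub>v x)"
      using transpose_vec_mult_scalar[OF C y x] comm_scalar_prod[of y N "transpose_mat C *\<^sub>v x"] C x y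
      by (simp flip: xCy)
    also have "\<dots> = y \<bullet> ((transpose_mat C * C) *\<^sub>v y)"
      using C y xCy by simp
    also have "\<dots> \<le> L * (y \<bullet> y)"
      by (rule L(2)[OF y])
    also have "\<dots> \<le> L * (K * (x \<bullet> (B *\<^sub>v x)))"
      using K(2)[OF x] L(1) unfolding y_def by simp
    finally have "x \<bullet> x / (L * K) \<le> x \<bullet> (B *\<^sub>v x)"
      using K(1) L(1) by (simp add: field_simps)
    then show "(t + 1 / (L * K)) * (x \<bullet> x) \<le> x \<bullet> (M *\<^sub>v x)"
      unfolding B_def char_matrix_quadratic_form[OF M x] by (simp add: algebra_simps)
  qed
qed

text \<open>
  The supremum of all lower bounds of the Rayleigh quotient is again a lower bound; the
  previous lemma forces it to be an eigenvalue, so the smallest eigenvalue cannot exceed it.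
\<close>

lemma smallest_eigenvalue_rayleigh:
  fixes M :: "real mat"
  assumes M: "M \<in> carrier_mat N N" and sym: "transpose_mat M = M" and "N > 0"
    and x: "x \<in> carrier_vec N"
  shows "smallest_eigenvalue M * (x \<bullet> x) \<le> x \<bullet> (M *\<^sub>v x)"
proof -
  define T where "T = {t. \<forall>x\<in>carrier_vec N. t * (x \<bullet> x) \<le> x \<bullet> (M *\<^sub>v x)}"
  define m where "m = Sup T"
  obtain K where K: "K > 0"
    "\<And>x. x \<in> carrier_vec N \<Longrightarrow> x \<bullet> ((- M) *\<^sub>v x) \<le> K * (x \<bullet> x)"
    using quadratic_form_bounded[of "- M" N] M by auto
  have "- K * (x \<bullet> x) \<le> x \<bullet> (M *\<^sub>v x)" if "x \<in> carrier_vec N" for x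
    using K(2)[OF that] M that by simp
  then have T_ne: "T \<noteq> {}"
    unfolding T_def by blast
  have "t \<le> M $$ (0, 0)" if "t \<in> T" for t
  proof -
    have "t * (unit_vec N 0 \<bullet> unit_vec N 0) \<le> unit_vec N 0 \<bullet> (M *\<^sub>v unit_vec N 0)"
      using that unfolding T_def by auto
    then show ?thesis
      using M \<open>N > 0\<close> by simp
  qed
  then have T_bdd: "bdd_above T"
    by (meson bdd_aboveI)
  have m_bound: "m * (x \<bullet> x) \<le> x \<bullet> (M *\<^sub>v x)" if x: "x \<in> carrier_vec N" for x
  proof (cases "x \<bullet> x = 0")
    case True
    obtain t where "t \<in> T"
      using T_ne by blast
    then show ?thesis
      using True x unfolding T_def by fastforce
  next
    case False
    have "x \<bullet> x \<ge> 0"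
      unfolding self_scalar_prod_sum[OF x] by (intro sum_nonneg) auto
    with False have pos: "x \<bullet> x > 0"
      by simp
    have "m \<le> (x \<bullet> (M *\<^sub>v x)) / (x \<bullet> x)"
      unfolding m_def
    proof (rule cSup_least[OF T_ne])
      fix t assume "t \<in> T"
      then show "t \<le> (x \<bullet> (M *\<^sub>v x)) / (x \<bullet> x)"
        using x pos unfolding T_def by (simp add: pos_le_divide_eq)
    qed
    then show ?thesis
      using pos by (simp add: pos_le_divide_eq)
  qed
  have "eigenvalue M m"
  proof (rule ccontr)
    assume "\<not> eigenvalue M m"
    then obtain \<epsilon> where "\<epsilon> > 0"
      and "\<And>x. x \<in> carrier_vec N \<Longrightarrow> (m + \<epsilon>) * (x \<bullet> x) \<le> x \<bullet> (M *\<^sub>v x)"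
      using rayleigh_bound_improves_off_spectrum[OF M sym m_bound] by metis
    then have "\<epsilon> > 0" "m + \<epsilon> \<in> T"
      unfolding T_def by simp_all
    then show False
      using cSup_upper[OF _ T_bdd, of "m + \<epsilon>"] unfolding m_def by simp
  qed
  then have "smallest_eigenvalue M \<le> m"
    unfolding smallest_eigenvalue_def using card_finite_spectrum(1)[OF M]
    by (intro Min_le) (auto simp: spectrum_def)
  moreover have "x \<bullet> x \<ge> 0"
    unfolding self_scalar_prod_sum[OF x] by (intro sum_nonneg) auto
  ultimately show ?thesis
    using m_bound[OF x] mult_right_mono[of "smallest_eigenvalue M" m "x \<bullet> x"] by linarith
qed

section \<open>The ratio bound for zero principal blocks\<close>

text \<open>
  The test vector is \<open>y = N z - k 1\<close>, where \<open>z\<close> is the indicator vector of \<open>T\<close> and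
  \<open>k = |T|\<close>: up to the factor \<open>N\<close>, the projection of \<open>z\<close> away from the eigenvector \<open>1\<close>.
  Since \<open>z \<bullet> M z = 0\<close>, one finds \<open>y \<bullet> M y = - N k\<^sup>2 r\<close> and \<open>y \<bullet> y = N k (N - k)\<close>.
\<close>

lemma zero_block_ratio_bound:
  fixes M :: "real mat" and r lam :: real
  assumes M: "M \<in> carrier_mat N N" and sym: "transpose_mat M = M"
    and row_sum: "\<And>i. i < N \<Longrightarrow> (\<Sum>j<N. M $$ (i, j)) = r"
    and T: "T \<subseteq> {..<N}" "T \<noteq> {}"
    and zero: "\<And>i j. i \<in> T \<Longrightarrow> j \<in> T \<Longrightarrow> M $$ (i, j) = 0"
    and lam: "\<And>x. x \<in> carrier_vec N \<Longrightarrow> lam * (x \<bullet> x) \<le> x \<bullet> (M *\<^sub>v x)"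
  shows "real (card T) * (r - lam) \<le> - real N * lam"
proof -
  define k where "k = real (card T)"
  define z where "z i = (of_bool (i \<in> T) :: real)" for i
  define y where "y = vec N (\<lambda>i. real N * z i - k)"
  have y: "y \<in> carrier_vec N"
    unfolding y_def by simp
  have finT: "finite T"
    using T(1) finite_subset by blast
  then have k: "k > 0"
    unfolding k_def using T(2) by (simp add: card_gt_0_iff)
  have N: "N > 0"
    using T by auto
  have sum_z: "(\<Sum>i<N. z i) = k"
    unfolding z_def k_def using T(1) by (simp add: Int_absorb1 Int_absorb2 Int_commute)
  have M_sym: "M $$ (i, j) = M $$ (j, i)" if "i < N" "j < N" for i j
    using arg_cong[OF sym, of "\<lambda>A. A $$ (i, j)"] M that by simp
  have zz: "(\<Sum>i<N. \<Sum>j<N. M $$ (i, j) * (z i * z j)) = 0"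
    by (intro sum.neutral ballI) (auto simp: z_def zero)
  have z1: "(\<Sum>i<N. \<Sum>j<N. M $$ (i, j) * z i) = k * r"
    by (simp add: sum_distrib_right[symmetric] row_sum sum_z mult.commute[of r]
        flip: sum_distrib_left)
  have z2: "(\<Sum>i<N. \<Sum>j<N. M $$ (i, j) * z j) = k * r"
    by (subst sum.swap) (use z1 in \<open>simp add: M_sym\<close>)
  have one: "(\<Sum>i<N. \<Sum>j<N. M $$ (i, j)) = real N * r"
    by (simp add: row_sum)
  have "y \<bullet> (M *\<^sub>v y) = (\<Sum>i<N. \<Sum>j<N. (real N)\<^sup>2 * (M $$ (i, j) * (z i * z j))
      - real N * k * (M $$ (i, j) * z i) - real N * k * (M $$ (i, j) * z j) + k\<^sup>2 * M $$ (i, j))"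
    unfolding quadratic_form_sum[OF M y]
    by (intro sum.cong refl) (simp add: y_def power2_eq_square algebra_simps)
  also have "\<dots> = - real N * k\<^sup>2 * r"
    by (simp only: sum.distrib sum_subtractf sum_distrib_left[symmetric] zz z1 z2 one)
      (simp add: power2_eq_square)
  finally have Q: "y \<bullet> (M *\<^sub>v y) = - real N * k\<^sup>2 * r" .
  have "y \<bullet> y = (\<Sum>i<N. (real N)\<^sup>2 * z i - 2 * real N * k * z i + k\<^sup>2)"
    unfolding self_scalar_prod_sum[OF y]
    by (intro sum.cong refl) (auto simp: y_def z_def power2_eq_square algebra_simps)
  also have "\<dots> = real N * k * (real N - k)"
    by (simp only: sum.distrib sum_subtractf sum_distrib_left[symmetric] sum_z)
      (simp add: power2_eq_square algebra_simps)
  finally have norm: "y \<bullet> y = real N * k * (real N - k)" .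
  have "real N * k * (lam * (real N - k)) \<le> real N * k * (- (k * r))"
    using lam[OF y] unfolding Q norm by (simp add: power2_eq_square mult_ac)
  then have "lam * (real N - k) \<le> - (k * r)"
    using N k by (simp only: mult_le_cancel_left_pos mult_pos_pos of_nat_0_less_iff)
  then show ?thesis
    unfolding k_def[symmetric] by (simp add: algebra_simps)
qed

section \<open>The integrated adjacency matrix of a regular graph\<close>

lemma edges_between_commute: "edges_between G u v = edges_between G v u"
  unfolding edges_between_def by (simp add: insert_commute)

lemma (in mixed_graph) sum_card_edges_between:
  assumes "u \<in> verts G"
  shows "(\<Sum>v\<in>verts G. card (edges_between G u v)) = card {e \<in> edges G. u \<in> ends G e}"
proof -
  have "{e \<in> edges G. u \<in> ends G e} = (\<Union>v\<in>verts G. edges_between G u v)"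
    using ends_wf assms unfolding edges_between_def by fastforce
  moreover have "card (\<Union>v\<in>verts G. edges_between G u v)
      = (\<Sum>v\<in>verts G. card (edges_between G u v))"
    using finite_verts
    by (intro card_UN_disjoint) (auto simp: edges_between_def finite_edges doubleton_eq_iff)
  ultimately show ?thesis
    by simp
qed

lemma (in mixed_graph) sum_card_arcs_from:
  "(\<Sum>v\<in>verts G. card (arcs_from_to G u v)) = out_degree G u"
proof -
  have "{a \<in> arcs G. tail G a = u} = (\<Union>v\<in>verts G. arcs_from_to G u v)"
    using head_wf unfolding arcs_from_to_def by auto
  moreover have "card (\<Union>v\<in>verts G. arcs_from_to G u v)
      = (\<Sum>v\<in>verts G. card (arcs_from_to G u v))"
    using finite_verts
    by (intro card_UN_disjoint) (auto simp: arcs_from_to_def finite_arcs)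
  ultimately show ?thesis
    unfolding out_degree_def by simp
qed

lemma (in mixed_graph) sum_card_arcs_to:
  "(\<Sum>v\<in>verts G. card (arcs_from_to G v u)) = in_degree G u"
proof -
  have "{a \<in> arcs G. head G a = u} = (\<Union>v\<in>verts G. arcs_from_to G v u)"
    using tail_wf unfolding arcs_from_to_def by auto
  moreover have "card (\<Union>v\<in>verts G. arcs_from_to G v u)
      = (\<Sum>v\<in>verts G. card (arcs_from_to G v u))"
    using finite_verts
    by (intro card_UN_disjoint) (auto simp: arcs_from_to_def finite_arcs)
  ultimately show ?thesis
    unfolding in_degree_def by simp
qed

lemma integrated_adjacency_mat_carrier:
  "integrated_adjacency_mat G vs \<in> carrier_mat (2 * length vs) (2 * length vs)"
  unfolding integrated_adjacency_mat_def undirected_adjacency_mat_def arc_adjacency_mat_def Let_def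
  by auto

lemma integrated_adjacency_mat_sym:
  "transpose_mat (integrated_adjacency_mat G vs) = integrated_adjacency_mat G vs"
  by (rule eq_matI)
    (auto simp: integrated_adjacency_mat_def undirected_adjacency_mat_def arc_adjacency_mat_def
      Let_def edges_between_commute)

context simple_mixed_graph
begin

text \<open>
  Without loops, the diagonal of the undirected block follows the same rule as its other
  entries: both count zero edges.
\<close>

lemma integrated_adjacency_mat_entries:
  assumes vs: "set vs = verts G" and "i < length vs" "j < length vs"
  defines "M \<equiv> integrated_adjacency_mat G vs" and "n \<equiv> length vs"
  shows "M $$ (i, j) = real (card (edges_between G (vs ! i) (vs ! j)))"
    and "M $$ (i, n + j) = real (card (arcs_from_to G (vs ! i) (vs ! j)))"
    and "M $$ (n + i, j) = real (card (arcs_from_to G (vs ! j) (vs ! i)))"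
    and "M $$ (n + i, n + j) = real (card (edges_between G (vs ! i) (vs ! j)))"
proof -
  have "edges_between G (vs ! i) (vs ! i) = {}"
    using assms nth_mem by (intro no_loops) blast
  then show "M $$ (i, j) = real (card (edges_between G (vs ! i) (vs ! j)))"
    and "M $$ (i, n + j) = real (card (arcs_from_to G (vs ! i) (vs ! j)))"
    and "M $$ (n + i, j) = real (card (arcs_from_to G (vs ! j) (vs ! i)))"
    and "M $$ (n + i, n + j) = real (card (edges_between G (vs ! i) (vs ! j)))"
    using assms(2,3)
    by (auto simp: M_def n_def integrated_adjacency_mat_def undirected_adjacency_mat_def
        arc_adjacency_mat_def Let_def)
qed

lemma integrated_adjacency_mat_row_sum:
  assumes reg: "regular G r" and vs: "distinct vs" "set vs = verts G" and i: "i < 2 * length vs"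
  shows "(\<Sum>j<2 * length vs. integrated_adjacency_mat G vs $$ (i, j)) = real r"
proof -
  define n where "n = length vs"
  define M where "M = integrated_adjacency_mat G vs"
  note entries = integrated_adjacency_mat_entries[OF vs(2), folded n_def M_def]
  have halves: "(\<Sum>j<2 * n. M $$ (i, j)) = (\<Sum>j<n. M $$ (i, j)) + (\<Sum>j<n. M $$ (i, n + j))" for i
    using sum.atLeastLessThan_concat[of 0 n "2 * n" "\<lambda>j. M $$ (i, j)"]
      sum.shift_bounds_nat_ivl[of "\<lambda>j. M $$ (i, j)" 0 n n]
    by (simp add: lessThan_atLeast0 add.commute mult_2)
  have over_verts: "(\<Sum>j<n. f (vs ! j)) = (\<Sum>v\<in>verts G. f v)" for f :: "_ \<Rightarrow> nat"
    using vs sum.reindex_bij_betw[OF bij_betw_nth[OF vs(1)], of "{..<n}" "verts G" f]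
    by (simp add: n_def)
  have deg: "(\<Sum>v\<in>verts G. card (edges_between G u v)) = degree G u"
    and out: "(\<Sum>v\<in>verts G. card (arcs_from_to G u v)) = out_degree G u"
    and into: "(\<Sum>v\<in>verts G. card (arcs_from_to G v u)) = out_degree G u"
    and r: "degree G u + out_degree G u = r" if "u \<in> verts G" for u
    using that reg sum_card_edges_between sum_card_arcs_from sum_card_arcs_to no_loops
    unfolding regular_def degree_def by auto
  show ?thesis
  proof (cases "i < n")
    case True
    then have u: "vs ! i \<in> verts G"
      unfolding n_def vs(2)[symmetric] by (rule nth_mem)
    have "(\<Sum>j<2 * n. M $$ (i, j)) = real (\<Sum>j<n. card (edges_between G (vs ! i) (vs ! j)))
        + real (\<Sum>j<n. card (arcs_from_to G (vs ! i) (vs ! j)))"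
      unfolding halves of_nat_sum using True by (simp add: entries)
    also have "\<dots> = real r"
      unfolding over_verts[of "\<lambda>v. card (edges_between G (vs ! i) v)"]
        over_verts[of "\<lambda>v. card (arcs_from_to G (vs ! i) v)"]
        deg[OF u] out[OF u] r[OF u, symmetric] by simp
    finally show ?thesis
      unfolding M_def n_def .
  next
    case False
    define k where "k = i - n"
    have k: "k < n" "i = n + k"
      using False i unfolding k_def n_def by auto
    from k(1) have u: "vs ! k \<in> verts G"
      unfolding n_def vs(2)[symmetric] by (rule nth_mem)
    have "(\<Sum>j<2 * n. M $$ (i, j)) = real (\<Sum>j<n. card (arcs_from_to G (vs ! j) (vs ! k)))
        + real (\<Sum>j<n. card (edges_between G (vs ! k) (vs ! j)))"
      unfolding halves of_nat_sum k(2) using k(1) by (simp add: entries)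
    also have "\<dots> = real r"
      unfolding over_verts[of "\<lambda>v. card (arcs_from_to G v (vs ! k))"]
        over_verts[of "\<lambda>v. card (edges_between G (vs ! k) v)"]
        deg[OF u] into[OF u] r[OF u, symmetric] by simp
    finally show ?thesis
      unfolding M_def n_def .
  qed
qed

lemma independent_set_ratio_bound:
  assumes reg: "regular G r" and vs: "distinct vs" "set vs = verts G"
    and S: "independent_set G S" "S \<noteq> {}"
  defines "lam \<equiv> smallest_eigenvalue (integrated_adjacency_mat G vs)"
  shows "real (card S) * (real r - lam) \<le> - real (card (verts G)) * lam"
proof -
  define n where "n = length vs"
  define M where "M = integrated_adjacency_mat G vs"
  note entries = integrated_adjacency_mat_entries[OF vs(2), folded n_def M_def]
  define I where "I = {i. i < n \<and> vs ! i \<in> S}"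
  \<comment> \<open>Every vertex owns one index in each half of the matrix.\<close>
  define T where "T = I \<union> (+) n ` I"
  have n: "n = card (verts G)"
    using vs distinct_card unfolding n_def by metis
  have "S \<subseteq> verts G"
    using S unfolding independent_set_def by simp
  then have "S \<subseteq> set vs"
    using vs by simp
  then have "(!) vs ` I = S"
    unfolding I_def n_def by (fastforce simp: in_set_conv_nth)
  moreover have "inj_on ((!) vs) I"
    using vs unfolding I_def n_def by (auto simp: inj_on_def nth_eq_iff_index_eq)
  ultimately have I: "card I = card S" "I \<noteq> {}"
    using S(2) card_image by fastforce+
  have "card T = card I + card ((+) n ` I)"
    unfolding T_def by (intro card_Un_disjoint) (auto simp: I_def)
  then have T: "card T = 2 * card S"
    using I by (simp add: card_image)
  have no_edge: "edges_between G (vs ! i) (vs ! j) = {}"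
    and no_arc: "arcs_from_to G (vs ! i) (vs ! j) = {}" if "i \<in> I" "j \<in> I" for i j
    using that S no_loops no_directed_loops
    unfolding I_def independent_set_def adjacent_def by (metis (lifting) mem_Collect_eq subsetD)+
  have "real (card T) * (real r - lam) \<le> - real (2 * n) * lam"
  proof (rule zero_block_ratio_bound)
    show "M \<in> carrier_mat (2 * n) (2 * n)" "transpose_mat M = M"
      unfolding M_def n_def
      by (rule integrated_adjacency_mat_carrier integrated_adjacency_mat_sym)+
    show "(\<Sum>j<2 * n. M $$ (i, j)) = real r" if "i < 2 * n" for i
      using that integrated_adjacency_mat_row_sum[OF reg vs] unfolding M_def n_def by simp
    show "T \<subseteq> {..<2 * n}" "T \<noteq> {}"
      using I(2) unfolding T_def I_def by auto
    show "M $$ (i, j) = 0" if "i \<in> T" "j \<in> T" for i j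
      using that no_edge no_arc unfolding T_def by (auto simp: entries I_def)
    have "n > 0"
      using n finite_verts verts_nonempty by (simp add: card_gt_0_iff)
    then show "lam * (x \<bullet> x) \<le> x \<bullet> (M *\<^sub>v x)" if "x \<in> carrier_vec (2 * n)" for x
      using smallest_eigenvalue_rayleigh[OF integrated_adjacency_mat_carrier
          integrated_adjacency_mat_sym, of vs x G] that
      unfolding lam_def M_def n_def by simp
  qed
  then have "2 * (real (card S) * (real r - lam)) \<le> 2 * (- real (card (verts G)) * lam)"
    unfolding T n of_nat_mult of_nat_numeral
    by (simp only: mult.assoc mult_minus_left mult_minus_right)
  then show ?thesis
    by linarith
qed

text \<open>
  The Rayleigh quotient of a unit vector is a diagonal entry, and these vanish. Hence the
  denominator \<open>r - \<lambda>\<close> of the bound is positive as soon as \<open>r > 0\<close>.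
\<close>

lemma smallest_eigenvalue_nonpos:
  assumes vs: "set vs = verts G"
  shows "smallest_eigenvalue (integrated_adjacency_mat G vs) \<le> 0"
proof -
  define n where "n = length vs"
  have n: "n > 0"
    using verts_nonempty unfolding n_def vs[symmetric] by simp
  have "edges_between G (vs ! 0) (vs ! 0) = {}"
    using n unfolding n_def by (intro no_loops) (simp flip: vs)
  then have "integrated_adjacency_mat G vs $$ (0, 0) = 0"
    using integrated_adjacency_mat_entries(1)[OF vs, of 0 0] n unfolding n_def by simp
  moreover have "integrated_adjacency_mat G vs \<in> carrier_mat (2 * n) (2 * n)"
    unfolding n_def by (rule integrated_adjacency_mat_carrier)
  ultimately show ?thesis
    using smallest_eigenvalue_rayleigh[OF _ integrated_adjacency_mat_sym,
        of G vs "2 * n" "unit_vec (2 * n) 0"] n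
    by simp
qed

end

theorem theorem8p10:
  fixes G :: "('v, 'e, 'a) mixed_graph" and vs :: "'v list" and n r :: nat and lam :: real
  assumes "simple_mixed_graph G"
    and "regular G r"
    and "r > 0"
    and "distinct vs" and "set vs = verts G"
    and "n = card (verts G)"
    and "lam = smallest_eigenvalue (integrated_adjacency_mat G vs)"
  shows "real (independence_number G) \<le> (- real n * lam) / (real r - lam)"
proof -
  interpret simple_mixed_graph G
    by fact
  have lam: "lam \<le> 0"
    using assms smallest_eigenvalue_nonpos by simp
  have "{S. independent_set G S} \<subseteq> Pow (verts G)"
    unfolding independent_set_def by blast
  then have "finite {S. independent_set G S}"
    using finite_verts finite_subset by blast
  moreover have "independent_set G {}"
    unfolding independent_set_def by simp
  ultimately have "independence_number G \<in> card ` {S. independent_set G S}"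
    unfolding independence_number_def by (intro Max_in) auto
  then obtain S where S: "independent_set G S" "independence_number G = card S"
    by blast
  have "real (card S) * (real r - lam) \<le> - real n * lam"
  proof (cases "S = {}")
    case True
    then show ?thesis
      using lam by (simp add: mult_nonneg_nonpos)
  next
    case False
    then show ?thesis
      using independent_set_ratio_bound[OF assms(2,4,5) S(1)] assms(6,7) by simp
  qed
  moreover have "real r - lam > 0"
    using lam \<open>r > 0\<close> by simp
  ultimately show ?thesis
    unfolding S(2) by (simp only: pos_le_divide_eq)
qed

end
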